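(* Let $n \ge 1$ and let $f : \{-1,1\}^n \to \{-1,1\}^n$ be any bijection. Then \[ \Pr_{x,y}\left[ \langle x, y \rangle \ge 0 \ \text{and}\ \langle f(x), f(y) \rangle \ge 0 \right] \ge \frac{1}{4} - O\!\left(\frac{1}{\sqrt{n}}\right), \] where $x,y$ are independent and uniformly random in $\{-1,1\}^n$, $\langle \cdot,\cdot\rangle$ is the standard inner product on $\mathbb{R}^n$, and the implied constant in $O(\cdot)$ is absolute (independent of $n$ and $f$). *)

theory Defs
  imports "HOL-Probability.Probability"
begin

text \<open>
  Vectors of length \<open>n\<close> are functions on \<open>{..<n}\<close>, rather than elements of a type indexed by a
  finite type, so that a constant can be quantified before \<open>n\<close>. Outside \<open>{..<n}\<close> they take
  the fixed value \<^const>\<open>undefined\<close>, so the cube has exactly \<open>2 ^ n\<close> elements.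
\<close>

definition cube :: "nat \<Rightarrow> (nat \<Rightarrow> real) set" where
  "cube n = {..<n} \<rightarrow>\<^sub>E {-1, 1}"

definition inner_prod :: "nat \<Rightarrow> (nat \<Rightarrow> real) \<Rightarrow> (nat \<Rightarrow> real) \<Rightarrow> real" where
  "inner_prod n x y = (\<Sum>i<n. x i * y i)"

end

theory Submission
  imports Defs
begin

text \<open>
  It suffices to show that the expectation of \<open>sgn \<langle>x, y\<rangle> * sgn \<langle>f x, f y\<rangle>\<close> is at least
  \<open>- O(1 / sqrt n)\<close>. In the characters \<open>\<chi>\<^sub>T\<close>, with \<open>\<lambda>\<^sub>T\<close> the Fourier coefficients of majority,
  it equals \<open>\<Sum>\<^sub>T\<^sub>U \<lambda>\<^sub>T \<lambda>\<^sub>U W\<^sub>T\<^sub>U\<close>, where \<open>W\<^sub>T\<^sub>U = (E \<chi>\<^sub>T(x) \<chi>\<^sub>U(f x))\<^sup>2\<close> is doubly stochastic because \<open>f\<close>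
  is a bijection. As \<open>\<lambda>\<^sub>T\<close> depends only on \<open>|T|\<close>, negative terms need \<open>|T| \<noteq> |U|\<close>, and since
  \<open>|\<lambda>|\<close> drops by a factor of about \<open>k / n\<close> from level \<open>k\<close> to level \<open>k + 2\<close>
  and is symmetric under \<open>k \<mapsto> n + 1 - k\<close>, they satisfy
  \<open>n |\<lambda>\<^sub>T \<lambda>\<^sub>U| \<le> 2 (|T| \<lambda>\<^sub>T\<^sup>2 + |U| \<lambda>\<^sub>U\<^sup>2)\<close>. Summing against \<open>W\<close> bounds the loss by \<open>4 / n\<close> times the total
  influence of majority, which is \<open>n\<close> times the probability of a tie among \<open>n - 1\<close> signs.
  An even \<open>n\<close> uses the coefficients of majority on \<open>n + 1\<close> signs.
\<close>

section \<open>Fourier analysis on the sign cube\<close>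

definition chi :: "'a set \<Rightarrow> ('a \<Rightarrow> real) \<Rightarrow> real" where
  "chi T x = (\<Prod>i\<in>T. x i)"

definition dif_op :: "(real \<Rightarrow> real) \<Rightarrow> real \<Rightarrow> real" where
  "dif_op F t = F (t + 1) - F (t - 1)"

definition sum_op :: "(real \<Rightarrow> real) \<Rightarrow> real \<Rightarrow> real" where
  "sum_op F t = F (t + 1) + F (t - 1)"

lemma dif_op_sum_op: "dif_op (sum_op F) = sum_op (dif_op F)"
  by (auto simp: dif_op_def sum_op_def fun_eq_iff)

lemma dif_op_sum_op_pow: "(dif_op ^^ p) ((sum_op ^^ q) F) = (sum_op ^^ q) ((dif_op ^^ p) F)"
proof -
  have "dif_op ((sum_op ^^ q) F) = (sum_op ^^ q) (dif_op F)" for F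
    by (induction q) (auto simp: dif_op_sum_op)
  then show ?thesis
    by (induction p) auto
qed

lemma sum_PiE_insert:
  assumes "a \<notin> A"
  shows "(\<Sum>x\<in>insert a A \<rightarrow>\<^sub>E {-1, 1::real}. g x) =
    (\<Sum>x\<in>A \<rightarrow>\<^sub>E {-1, 1}. g (x(a := 1)) + (g (x(a := -1)) :: real))"
proof -
  have "(\<Sum>x\<in>insert a A \<rightarrow>\<^sub>E {-1, 1::real}. g x) =
      (\<Sum>(y, x)\<in>{-1, 1} \<times> (A \<rightarrow>\<^sub>E {-1, 1}). g (x(a := y)))"
    unfolding PiE_insert_eq using assms
    by (subst sum.reindex) (auto intro: inj_combinator simp: case_prod_unfold
        inj_combinator[of a A "\<lambda>_. {-1, 1}", unfolded case_prod_unfold])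
  then show ?thesis
    by (simp add: sum.cartesian_product[symmetric] sum.distrib add.commute)
qed

text \<open>Summing out the sign of one coordinate replaces \<open>F\<close> by
  \<open>dif_op F\<close> if the coordinate lies in \<open>T\<close> and by \<open>sum_op F\<close>
  otherwise; the two operators commute. Hence the unnormalized Fourier coefficient of a symmetric
  function depends only on set sizes. The induction generalizes \<open>F\<close> because its
  hypothesis is applied to \<open>dif_op F\<close> or \<open>sum_op F\<close>.\<close>

lemma sum_PiE_chi:
  assumes "finite A" "T \<subseteq> A"
  shows "(\<Sum>x\<in>A \<rightarrow>\<^sub>E {-1, 1}. F (t + (\<Sum>i\<in>A. x i)) * chi T x) =
    (dif_op ^^ card T) ((sum_op ^^ card (A - T)) F) t"
  using assms
proof (induction A arbitrary: T F t rule: finite_induct)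
  case empty
  then show ?case by (simp add: chi_def)
next
  case (insert a A)
  have upd: "(\<Sum>i\<in>A. (x(a := y)) i) = (\<Sum>i\<in>A. x i)" for x :: "_ \<Rightarrow> real" and y
    using insert.hyps by (intro sum.cong) auto
  have sumI: "(\<Sum>i\<in>insert a A. (x(a := y)) i) = y + (\<Sum>i\<in>A. x i)" for x :: "_ \<Rightarrow> real" and y
    using insert.hyps by (simp add: upd del: fun_upd_apply) simp
  show ?case
  proof (cases "a \<in> T")
    case True
    define R where "R = T - {a}"
    have R: "R \<subseteq> A" "T = insert a R" "a \<notin> R" "finite R"
      using True insert.prems insert.hyps finite_subset[of R A] by (auto simp: R_def)
    have chiT: "chi T (x(a := y)) = y * chi R x" for x y
      unfolding chi_def R(2) using R by (auto intro!: prod.cong)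
    have diff: "insert a A - T = A - R" using R insert.hyps by auto
    have "(\<Sum>x\<in>insert a A \<rightarrow>\<^sub>E {-1, 1}. F (t + (\<Sum>i\<in>insert a A. x i)) * chi T x) =
      (\<Sum>x\<in>A \<rightarrow>\<^sub>E {-1, 1}. dif_op F (t + (\<Sum>i\<in>A. x i)) * chi R x)"
      unfolding sum_PiE_insert[OF insert.hyps(2)] sumI chiT dif_op_def
      by (intro sum.cong) (auto simp: algebra_simps)
    also have "\<dots> = (dif_op ^^ card R) ((sum_op ^^ card (A - R)) (dif_op F)) t"
      using insert.IH R by blast
    also have "(dif_op ^^ card R) ((sum_op ^^ card (A - R)) (dif_op F)) = (dif_op ^^ Suc (card R)) ((sum_op ^^ card (A - R)) F)"
      using dif_op_sum_op_pow[of "Suc (card R)" "card (A - R)" F] dif_op_sum_op_pow[of "card R" "card (A - R)" "dif_op F"]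
      by (metis funpow_swap1 funpow.simps(2) comp_apply)
    finally show ?thesis using R diff by simp
  next
    case False
    have R: "T \<subseteq> A" using False insert.prems by auto
    have chiT: "chi T (x(a := y)) = chi T x" for x y
      unfolding chi_def using False by (auto intro!: prod.cong)
    have diff: "insert a A - T = insert a (A - T)" using False by auto
    have "(\<Sum>x\<in>insert a A \<rightarrow>\<^sub>E {-1, 1}. F (t + (\<Sum>i\<in>insert a A. x i)) * chi T x) =
      (\<Sum>x\<in>A \<rightarrow>\<^sub>E {-1, 1}. sum_op F (t + (\<Sum>i\<in>A. x i)) * chi T x)"
      unfolding sum_PiE_insert[OF insert.hyps(2)] sumI chiT sum_op_def
      by (intro sum.cong) (auto simp: algebra_simps)
    also have "\<dots> = (dif_op ^^ card T) ((sum_op ^^ card (A - T)) (sum_op F)) t"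
      using insert.IH R by blast
    finally show ?thesis using insert.hyps diff by (simp add: funpow_swap1)
  qed
qed

section \<open>Orthogonality of characters, Parseval and Fourier inversion\<close>

lemma sum_chi_Pow:
  assumes "finite A"
  shows "(\<Sum>U\<in>Pow A. chi U x) = (\<Prod>i\<in>A. 1 + x i)"
  using assms
proof (induction A rule: finite_induct)
  case (insert a A)
  have inj: "inj_on (insert a) (Pow A)"
    using insert.hyps by (auto simp: inj_on_def)
  have "(\<Sum>U\<in>Pow (insert a A). chi U x) = (\<Sum>U\<in>Pow A. chi U x) + (\<Sum>U\<in>Pow A. chi (insert a U) x)"
    unfolding Pow_insert using insert.hyps
    by (subst sum.union_disjoint) (auto simp: sum.reindex[OF inj])
  also have "(\<Sum>U\<in>Pow A. chi (insert a U) x) = (\<Sum>U\<in>Pow A. x a * chi U x)"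
  proof (intro sum.cong refl)
    fix U assume "U \<in> Pow A"
    then have "finite U" "a \<notin> U"
      using insert.hyps by (auto intro: finite_subset)
    then show "chi (insert a U) x = x a * chi U x" by (simp add: chi_def)
  qed
  finally show ?case using insert by (simp add: sum_distrib_left[symmetric] algebra_simps)
qed (simp add: chi_def)

lemma chi_mult: "chi T x * chi T y = chi T (\<lambda>i. x i * y i)"
  by (simp add: chi_def prod.distrib)

lemma chi_restrict: "T \<subseteq> A \<Longrightarrow> chi T (restrict x A) = chi T x"
  by (auto simp: chi_def intro!: prod.cong)

lemma chi_square:
  assumes "x \<in> A \<rightarrow>\<^sub>E {-1, 1}" "T \<subseteq> A"
  shows "(chi T x)\<^sup>2 = 1"
proof -
  have "chi T x * chi T x = (\<Prod>i\<in>T. 1)"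
    unfolding chi_mult unfolding chi_def using assms by (intro prod.cong) (force simp: PiE_iff)+
  then show ?thesis by (simp add: power2_eq_square)
qed

text \<open>The sum over \<open>U\<close> factors into the product of \<open>1 + x i * y i\<close>,
  and a single coordinate where \<open>x\<close> and \<open>y\<close> differ makes a factor
  vanish.\<close>

lemma chi_orthogonal:
  assumes "finite A" "x \<in> A \<rightarrow>\<^sub>E {-1, 1}" "y \<in> A \<rightarrow>\<^sub>E {-1, 1}"
  shows "(\<Sum>U\<in>Pow A. chi U x * chi U y) = (if x = y then 2 ^ card A else 0)"
proof -
  have *: "(\<Sum>U\<in>Pow A. chi U x * chi U y) = (\<Prod>i\<in>A. 1 + x i * y i)"
    using assms by (simp add: chi_mult sum_chi_Pow)
  show ?thesis
  proof (cases "x = y")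
    case True
    have "(\<Prod>i\<in>A. 1 + x i * y i) = (\<Prod>i\<in>A. 2)"
      using assms True by (intro prod.cong) (auto simp: PiE_iff)
    then show ?thesis using * True by simp
  next
    case False
    then obtain i where "i \<in> A" "x i \<noteq> y i"
      using assms by (metis PiE_ext)
    moreover from this have "1 + x i * y i = 0"
      using assms(2,3) by (force simp: PiE_iff)
    ultimately show ?thesis using * False assms by auto
  qed
qed

text \<open>Parseval for weights carried by the points \<open>g x\<close>: injectivity of
  \<open>g\<close> leaves only diagonal terms after expanding the square. Taking \<open>g\<close> to
  be a bijection of the cube or the identity gives the row and column sums of the matrix
  \<open>W\<close> below.\<close>

lemma sum_Pow_square:
  fixes w :: "'b \<Rightarrow> real"
  assumes "finite A" "finite I" "inj_on g I" "g ` I \<subseteq> A \<rightarrow>\<^sub>E {-1, 1}"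
  shows "(\<Sum>U\<in>Pow A. (\<Sum>x\<in>I. w x * chi U (g x))\<^sup>2) = 2 ^ card A * (\<Sum>x\<in>I. (w x)\<^sup>2)"
proof -
  have "(\<Sum>U\<in>Pow A. (\<Sum>x\<in>I. w x * chi U (g x))\<^sup>2) =
      (\<Sum>U\<in>Pow A. \<Sum>x\<in>I. \<Sum>y\<in>I. w x * w y * (chi U (g x) * chi U (g y)))"
    by (intro sum.cong refl) (simp add: power2_eq_square sum_product mult_ac)
  also have "\<dots> = (\<Sum>x\<in>I. \<Sum>U\<in>Pow A. \<Sum>y\<in>I. w x * w y * (chi U (g x) * chi U (g y)))"
    by (rule sum.swap)
  also have "\<dots> = (\<Sum>x\<in>I. \<Sum>y\<in>I. w x * w y * (\<Sum>U\<in>Pow A. chi U (g x) * chi U (g y)))"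
    by (intro sum.cong refl, subst sum.swap) (simp add: sum_distrib_left)
  also have "\<dots> = (\<Sum>x\<in>I. \<Sum>y\<in>I. if x = y then w x * w y * 2 ^ card A else 0)"
  proof (intro sum.cong refl)
    fix x y assume "x \<in> I" "y \<in> I"
    moreover from this have "(\<Sum>U\<in>Pow A. chi U (g x) * chi U (g y)) = (if g x = g y then 2 ^ card A else 0)"
      using assms by (intro chi_orthogonal) auto
    ultimately show "w x * w y * (\<Sum>U\<in>Pow A. chi U (g x) * chi U (g y)) =
        (if x = y then w x * w y * 2 ^ card A else 0)"
      using assms(3) by (auto simp: inj_on_def)
  qed
  also have "\<dots> = 2 ^ card A * (\<Sum>x\<in>I. (w x)\<^sup>2)"
    using assms by (simp add: sum_distrib_left power2_eq_square mult_ac)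
  finally show ?thesis .
qed

lemma finite_sign_cube: "finite A \<Longrightarrow> finite (A \<rightarrow>\<^sub>E {-1, 1::real})"
  by (intro finite_PiE) auto

text \<open>Since \<open>chi T x * chi T y\<close> is the character at the pointwise product
  \<open>z\<close> of \<open>x\<close> and \<open>y\<close>, this is Fourier inversion at
  \<open>z\<close>, with coefficients supplied by \<open>sum_PiE_chi\<close> at
  \<open>t = 0\<close>.\<close>

lemma fourier_inversion:
  assumes "finite A" "x \<in> A \<rightarrow>\<^sub>E {-1, 1}" "y \<in> A \<rightarrow>\<^sub>E {-1, 1}"
  shows "(\<Sum>T\<in>Pow A. (dif_op ^^ card T) ((sum_op ^^ card (A - T)) F) 0 * (chi T x * chi T y)) =
    2 ^ card A * F (\<Sum>i\<in>A. x i * y i)"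
proof -
  define z where "z = restrict (\<lambda>i. x i * y i) A"
  have z: "z \<in> A \<rightarrow>\<^sub>E {-1, 1}" using assms by (force simp: z_def PiE_iff)
  have "(\<Sum>T\<in>Pow A. (dif_op ^^ card T) ((sum_op ^^ card (A - T)) F) 0 * (chi T x * chi T y)) =
     (\<Sum>T\<in>Pow A. \<Sum>u\<in>A \<rightarrow>\<^sub>E {-1, 1}. F (\<Sum>i\<in>A. u i) * (chi T u * chi T z))"
  proof (intro sum.cong refl)
    fix T assume "T \<in> Pow A"
    then have "chi T x * chi T y = chi T z"
      unfolding chi_mult z_def by (simp add: chi_restrict)
    then show "(dif_op ^^ card T) ((sum_op ^^ card (A - T)) F) 0 * (chi T x * chi T y) =
       (\<Sum>u\<in>A \<rightarrow>\<^sub>E {-1, 1}. F (\<Sum>i\<in>A. u i) * (chi T u * chi T z))"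
      using sum_PiE_chi[of A T F 0, symmetric] assms(1) \<open>T \<in> Pow A\<close>
      by (simp add: sum_distrib_right mult.assoc)
  qed
  also have "\<dots> = (\<Sum>u\<in>A \<rightarrow>\<^sub>E {-1, 1}. F (\<Sum>i\<in>A. u i) * (\<Sum>T\<in>Pow A. chi T u * chi T z))"
    by (subst sum.swap) (simp add: sum_distrib_left)
  also have "\<dots> = (\<Sum>u\<in>A \<rightarrow>\<^sub>E {-1, 1}. if u = z then F (\<Sum>i\<in>A. u i) * 2 ^ card A else 0)"
    using assms z by (intro sum.cong refl) (simp add: chi_orthogonal)
  also have "\<dots> = 2 ^ card A * F (\<Sum>i\<in>A. z i)"
    using z assms(1) by (simp add: finite_sign_cube)
  also have "(\<Sum>i\<in>A. z i) = (\<Sum>i\<in>A. x i * y i)"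
    by (simp add: z_def)
  finally show ?thesis .
qed

section \<open>The Fourier coefficients of majority\<close>

definition tie :: "real \<Rightarrow> real" where
  "tie t = (if t = 0 then 1 else 0)"

text \<open>Vanishing off the odd integers makes the difference of \<open>odd_sgn\<close> a multiple of \<open>tie\<close> everywhere.\<close>

definition odd_sgn :: "real \<Rightarrow> real" where
  "odd_sgn t = (if \<exists>m::int. t = 2 * of_int m + 1 then sgn t else 0)"

text \<open>By \<open>sum_PiE_chi\<close> this is the unnormalized Fourier coefficient, at a set of
  size \<open>p\<close>, of the indicator that \<open>p + q\<close> signs sum to zero.\<close>

definition tie_coeff :: "nat \<Rightarrow> nat \<Rightarrow> real" where
  "tie_coeff p q = (dif_op ^^ p) ((sum_op ^^ q) tie) 0"

lemma dif_op_odd_sgn: "dif_op odd_sgn = (\<lambda>t. 2 * tie t)"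
proof
  fix t :: real
  show "dif_op odd_sgn t = 2 * tie t"
  proof (cases "\<exists>m::int. t = 2 * of_int m")
    case True
    then obtain m :: int where m: "t = 2 * of_int m" by auto
    have a: "odd_sgn (t + 1) = sgn (t + 1)"
      using m by (auto simp: odd_sgn_def)
    have "t - 1 = 2 * of_int (m - 1) + 1"
      using m by simp
    then have b: "odd_sgn (t - 1) = sgn (t - 1)"
      unfolding odd_sgn_def by meson
    consider "m \<ge> 1" | "m = 0" | "m \<le> -1" by linarith
    then show ?thesis
    proof cases
      case 1
      then have "t \<ge> 2" using m by simp
      then show ?thesis by (simp add: dif_op_def a b tie_def)
    next
      case 3
      then have "(of_int m :: real) \<le> of_int (-1)" unfolding of_int_le_iff .
      then have "t \<le> -2" using m by simp
      then show ?thesis by (simp add: dif_op_def a b tie_def sgn_if)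
    next
      case 2
      then show ?thesis using a b m by (simp add: dif_op_def tie_def)
    qed
  next
    case False
    have "\<nexists>m::int. t - 1 = 2 * of_int m + 1"
    proof
      assume "\<exists>m::int. t - 1 = 2 * of_int m + 1"
      then obtain m :: int where "t = 2 * of_int (m + 1)" by (auto simp: algebra_simps)
      then show False using False by blast
    qed
    moreover have "t \<noteq> 0" using False[simplified, rule_format, of 0] by simp
    ultimately show ?thesis using False by (simp add: dif_op_def odd_sgn_def tie_def)
  qed
qed

lemma op_pow_scale: "(sum_op ^^ q) (\<lambda>t. c * F t) = (\<lambda>t. c * (sum_op ^^ q) F t)"
  "(dif_op ^^ q) (\<lambda>t. c * F t) = (\<lambda>t. c * (dif_op ^^ q) F t)"
  by (induction q) (auto simp: sum_op_def dif_op_def fun_eq_iff algebra_simps)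

text \<open>One of the differences is spent on \<open>odd_sgn\<close> itself, whose only jump is at
  a tie.\<close>

lemma odd_sgn_coeff_Suc: "(dif_op ^^ Suc k) ((sum_op ^^ q) odd_sgn) 0 = 2 * tie_coeff k q"
proof -
  have "(dif_op ^^ Suc k) ((sum_op ^^ q) odd_sgn) = (dif_op ^^ k) ((sum_op ^^ q) (dif_op odd_sgn))"
    using dif_op_sum_op_pow[of 1 q odd_sgn] by (simp add: funpow_Suc_right del: funpow.simps)
  then show ?thesis
    by (simp add: dif_op_odd_sgn op_pow_scale tie_coeff_def)
qed

lemma odd_sgn_uminus: "odd_sgn (- t) = - odd_sgn t"
proof -
  have "(\<exists>m::int. - t = 2 * of_int m + 1) \<longleftrightarrow> (\<exists>m::int. t = 2 * of_int m + 1)" for t :: real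
  proof -
    have "\<exists>m::int. - t = 2 * of_int m + 1" if "t = 2 * of_int m + 1" for m :: int and t :: real
      using that by (intro exI[of _ "- m - 1"]) auto
    then show ?thesis by (metis minus_minus)
  qed
  then show ?thesis by (simp add: odd_sgn_def sgn_minus)
qed

text \<open>\<open>sum_op\<close> preserves parity and \<open>dif_op\<close> reverses it, so evenly
  many differences leave an odd function, which vanishes at 0.\<close>

lemma odd_sgn_coeff_even:
  assumes "even k"
  shows "(dif_op ^^ k) ((sum_op ^^ q) odd_sgn) 0 = 0"
proof -
  have 1: "(sum_op ^^ q) odd_sgn (- t) = - (sum_op ^^ q) odd_sgn t" for t
  proof (induction q arbitrary: t)
    case (Suc q)
    show ?case using Suc[of "t - 1"] Suc[of "t + 1"] by (simp add: sum_op_def[of _ t] sum_op_def[of _ "- t"])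
  qed (simp add: odd_sgn_uminus)
  define G where "G = (sum_op ^^ q) odd_sgn"
  have "(dif_op ^^ k) G (- t) = - ((-1) ^ k * (dif_op ^^ k) G t)" for t
  proof (induction k arbitrary: t)
    case (Suc k)
    show ?case using Suc[of "t - 1"] Suc[of "t + 1"] by (simp add: dif_op_def[of _ t] dif_op_def[of _ "- t"] right_diff_distrib)
  qed (simp add: 1 G_def)
  from this[of 0] assms show ?thesis by (simp add: G_def)
qed

section \<open>Recurrence for the tie coefficients and size of the central one\<close>

lemma dif_op_pow_times: "(dif_op ^^ p) (\<lambda>t. t * F t) t = t * (dif_op ^^ p) F t + real p * (dif_op ^^ (p - 1)) (sum_op F) t"
proof (induction p arbitrary: t)
  case (Suc p)
  have 1: "real p * dif_op ((dif_op ^^ (p - 1)) (sum_op F)) t = real p * sum_op ((dif_op ^^ p) F) t"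
    using dif_op_sum_op_pow[of p 1 F] by (cases p) auto
  have 2: "(dif_op ^^ p) (sum_op F) = sum_op ((dif_op ^^ p) F)"
    using dif_op_sum_op_pow[of p 1 F] by simp
  have "(dif_op ^^ Suc p) (\<lambda>t. t * F t) t = t * (dif_op ^^ Suc p) F t + sum_op ((dif_op ^^ p) F) t
      + real p * dif_op ((dif_op ^^ (p - 1)) (sum_op F)) t"
    by (simp add: dif_op_def[of _ t] sum_op_def[of _ t] Suc algebra_simps)
  then show ?case unfolding 1 by (simp add: 2 algebra_simps)
qed simp

text \<open>Moving \<open>sum_op\<close> past multiplication by \<open>t\<close> costs one
  \<open>dif_op\<close>, and in \<open>dif_op_pow_times\<close> the roles are swapped; each of the
  \<open>q\<close> factors contributes once. At \<open>q = 0\<close> the truncated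
  \<open>q - 1\<close> is harmless, since its term carries the factor \<open>real q\<close>.\<close>

lemma sum_op_pow_times: "(sum_op ^^ q) (\<lambda>t. t * F t) t = t * (sum_op ^^ q) F t + real q * (sum_op ^^ (q - 1)) (dif_op F) t"
proof (induction q arbitrary: t)
  case (Suc q)
  have 1: "real q * sum_op ((sum_op ^^ (q - 1)) (dif_op F)) t = real q * dif_op ((sum_op ^^ q) F) t"
    using dif_op_sum_op_pow[of 1 q F] by (cases q) auto
  have 2: "(sum_op ^^ q) (dif_op F) = dif_op ((sum_op ^^ q) F)"
    using dif_op_sum_op_pow[of 1 q F] by simp
  have "(sum_op ^^ Suc q) (\<lambda>t. t * F t) t = t * (sum_op ^^ Suc q) F t + dif_op ((sum_op ^^ q) F) t
      + real q * sum_op ((sum_op ^^ (q - 1)) (dif_op F)) t"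
    by (simp add: dif_op_def[of _ t] sum_op_def[of _ t] Suc algebra_simps)
  then show ?case unfolding 1 by (simp add: 2 algebra_simps)
qed simp

lemma dif_op_pow_add: "(dif_op ^^ p) (\<lambda>t. F t + G t) = (\<lambda>t. (dif_op ^^ p) F t + (dif_op ^^ p) G t)"
  by (induction p) (auto simp: dif_op_def fun_eq_iff)

text \<open>
  The function \<open>t * tie t\<close> is zero; commuting the multiplication by \<open>t\<close> past
  \<open>dif_op\<close> and \<open>sum_op\<close> yields the recurrence.
\<close>

lemma tie_coeff_recurrence: "real p * tie_coeff (p - 1) (Suc q) + real q * tie_coeff (Suc p) (q - 1) = 0"
proof -
  have z: "(\<lambda>t. t * tie t) = (\<lambda>t. 0 * tie t)"
    by (auto simp: tie_def)
  have sm: "(sum_op ^^ q) (\<lambda>t. t * tie t) =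
      (\<lambda>t. t * (sum_op ^^ q) tie t + real q * (sum_op ^^ (q - 1)) (dif_op tie) t)"
    by (rule ext) (rule sum_op_pow_times)
  have "0 = (dif_op ^^ p) ((sum_op ^^ q) (\<lambda>t. t * tie t)) 0"
    unfolding z op_pow_scale by simp
  also have "\<dots> = real p * (dif_op ^^ (p - 1)) ((sum_op ^^ Suc q) tie) 0
      + real q * (dif_op ^^ p) ((sum_op ^^ (q - 1)) (dif_op tie)) 0"
    unfolding sm by (simp add: dif_op_pow_add dif_op_pow_times op_pow_scale funpow_swap1)
  also have "(dif_op ^^ p) ((sum_op ^^ (q - 1)) (dif_op tie)) = (dif_op ^^ Suc p) ((sum_op ^^ (q - 1)) tie)"
    using dif_op_sum_op_pow[of 1 "q - 1" tie] by (simp add: funpow_Suc_right del: funpow.simps)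
  finally show ?thesis by (simp add: tie_coeff_def)
qed

text \<open>This is the recursion of the central binomial coefficients. It combines the operator
  identity that two differences equal two sums minus 4 times the identity with the recurrence
  linking levels 0 and 2.\<close>

lemma tie_coeff_central_Suc: "real (2 * M + 2) * tie_coeff 0 (2 * M + 2) = 4 * real (2 * M + 1) * tie_coeff 0 (2 * M)"
proof -
  have "tie_coeff 2 (2 * M) = tie_coeff 0 (2 * M + 2) - 4 * tie_coeff 0 (2 * M)"
    by (simp add: tie_coeff_def numeral_2_eq_2 dif_op_def sum_op_def)
  moreover have "tie_coeff 0 (2 * M + 2) + real (2 * M + 1) * tie_coeff 2 (2 * M) = 0"
    using tie_coeff_recurrence[of 1 "2 * M + 1"] by (simp add: numeral_2_eq_2)
  ultimately have "tie_coeff 0 (2 * M + 2) + real (2 * M + 1) * (tie_coeff 0 (2 * M + 2) - 4 * tie_coeff 0 (2 * M)) = 0"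
    by simp
  then show ?thesis by (simp add: algebra_simps)
qed

text \<open>Divided by \<open>16 ^ M\<close>, the left side is nonincreasing in \<open>M\<close>,
  because \<open>(2 * M + 1) * (2 * M + 3) \<le> (2 * M + 2)\<^sup>2\<close>.\<close>

lemma tie_coeff_central_square_le: "(tie_coeff 0 (2 * M))\<^sup>2 * real (2 * M + 1) \<le> 16 ^ M"
proof (induction M)
  case 0
  then show ?case by (simp add: tie_coeff_def tie_def)
next
  case (Suc M)
  define b where "b = tie_coeff 0 (2 * M)"
  define u where "u = real M"
  have e: "tie_coeff 0 (2 * Suc M) = 4 * (2 * u + 1) * b / (2 * u + 2)"
    using tie_coeff_central_Suc[of M] unfolding b_def u_def by (simp add: field_simps)
  have "(tie_coeff 0 (2 * Suc M))\<^sup>2 * real (2 * Suc M + 1)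
      = 16 * (b\<^sup>2 * (2 * u + 1)) * ((2 * u + 1) * (2 * u + 3) / (2 * u + 2)\<^sup>2)"
    unfolding e by (simp add: u_def power_divide power_mult_distrib field_simps power2_eq_square)
  also have "\<dots> \<le> 16 * (b\<^sup>2 * (2 * u + 1)) * 1"
  proof (rule mult_left_mono)
    have "(2 * u + 2)\<^sup>2 > 0" by (simp add: u_def)
    then show "(2 * u + 1) * (2 * u + 3) / (2 * u + 2)\<^sup>2 \<le> 1"
      by (simp add: divide_le_eq_1) (simp add: power2_eq_square algebra_simps)
  qed (simp add: u_def)
  also have "\<dots> \<le> 16 * 16 ^ M"
    using Suc unfolding b_def u_def by (simp add: algebra_simps)
  finally show ?case by simp
qed

lemma tie_coeff_central_le: "tie_coeff 0 (2 * M) / 4 ^ M \<le> 1 / sqrt (real (2 * M + 1))"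
proof -
  have "(tie_coeff 0 (2 * M) / 4 ^ M * sqrt (real (2 * M + 1)))\<^sup>2 = (tie_coeff 0 (2 * M))\<^sup>2 * real (2 * M + 1) / 16 ^ M"
    by (simp add: power_mult_distrib power_divide power2_eq_square power_mult_distrib[symmetric])
  also have "\<dots> \<le> 1\<^sup>2"
    using tie_coeff_central_square_le[of M] by simp
  finally have "tie_coeff 0 (2 * M) / 4 ^ M * sqrt (real (2 * M + 1)) \<le> 1"
    by (rule power2_le_imp_le) simp
  then show ?thesis
    by (simp add: pos_le_divide_eq)
qed

text \<open>Here \<open>b m\<close> stands for the absolute coefficient of majority at level
  \<open>2 * m + 1\<close>. It is symmetric about \<open>M / 2\<close> and decreasing on the lower
  half, where the recurrence gives a drop strong enough for the bound. On the upper half the weight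
  \<open>2 * (2 * m + 1)\<close> already exceeds \<open>2 * M + 1\<close>.\<close>

lemma two_level_bound:
  fixes b :: "nat \<Rightarrow> real"
  assumes nonneg: "\<And>m. b m \<ge> 0"
    and rec: "\<And>m. m < M \<Longrightarrow> (2 * real m + 1) * b m = (2 * real M - 2 * real m - 1) * b (Suc m)"
    and ij: "i \<le> M" "j \<le> M" "i \<noteq> j"
  shows "(2 * real M + 1) * (b i * b j) \<le>
    2 * ((2 * real i + 1) * (b i)\<^sup>2 + (2 * real j + 1) * (b j)\<^sup>2)"
proof -
  \<comment> \<open>The recurrence is invariant under \<open>m \<mapsto> M - m\<close>, so the two solutions are proportional.\<close>
  have ratio: "b m * b M = b (M - m) * b 0" if "m \<le> M" for m
    using that
  proof (induction m)
    case (Suc m)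
    define k where "k = M - Suc m"
    have k: "M - m = Suc k" "k < M" "real M = real k + real m + 1"
      using Suc.prems by (auto simp: k_def)
    have r1: "(2 * real m + 1) * b m = (2 * real k + 1) * b (Suc m)"
      using rec[of m] Suc.prems k by simp
    have r2: "(2 * real k + 1) * b k = (2 * real m + 1) * b (Suc k)"
      using rec[of k] k by simp
    have "(2 * real k + 1) * (b (Suc m) * b M) = (2 * real m + 1) * (b m * b M)"
      using r1 by (metis mult.assoc)
    also have "\<dots> = (2 * real m + 1) * (b (Suc k) * b 0)"
      using Suc k by simp
    also have "\<dots> = (2 * real k + 1) * (b k * b 0)"
      using r2 by (metis mult.assoc)
    finally show ?case by (simp add: k_def)
  qed simp
  \<comment> \<open>At \<open>m = M\<close>, \<open>ratio\<close> forces \<open>b M = b 0\<close>,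
    and cancelling \<open>b 0\<close> gives the symmetry. If \<open>b 0 = 0\<close>, the recurrence
    makes all of \<open>b\<close> vanish up to \<open>M\<close>.\<close>
  have sym: "b (M - m) = b m" if "m \<le> M" for m
  proof (cases "b 0 = 0")
    case True
    have "b m = 0" if "m \<le> M" for m
      using that
    proof (induction m)
      case (Suc m)
      have "2 * real M - 2 * real m - 1 > 0" using Suc.prems by simp
      then show ?case using rec[of m] Suc by auto
    qed (simp add: True)
    then show ?thesis using that by simp
  next
    case False
    have "b M * b M = b 0 * b 0" using ratio[of M] by simp
    then have "b M = b 0"
      using nonneg by (metis power2_eq_square power2_eq_imp_eq)
    then show ?thesis using ratio[OF that] False by simp
  qed
  have step: "b (Suc m) \<le> b m" if "2 * Suc m \<le> M" for m
  proof -
    have "(2 * real m + 1) * b (Suc m) \<le> (2 * real M - 2 * real m - 1) * b (Suc m)"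
      using that nonneg by (intro mult_right_mono) auto
    also have "\<dots> = (2 * real m + 1) * b m" using rec[of m] that by simp
    finally show ?thesis by (simp add: mult_le_cancel_left_pos)
  qed
  have dec: "b l \<le> b m" if "m \<le> l" "2 * l \<le> M" for m l
    using that
  proof (induction l rule: dec_induct)
    case (step n)
    then show ?case using step(3) \<open>\<And>m. 2 * Suc m \<le> M \<Longrightarrow> b (Suc m) \<le> b m\<close>[of n] by simp
  qed simp
  \<comment> \<open>Monotonicity reduces \<open>l\<close> to \<open>Suc m\<close>; since
    \<open>Suc m\<close> is at most \<open>M / 2\<close>, the factor
    \<open>2 * (2 * M - 2 * m - 1)\<close> is at least \<open>2 * M + 1\<close>, and the recurrence
    turns \<open>b (Suc m)\<close> into \<open>b m\<close>.\<close>
  have key: "(2 * real M + 1) * b l \<le> 2 * (2 * real m + 1) * b m" if "m < l" "2 * l \<le> M" for m l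
  proof -
    have "(2 * real M + 1) * b l \<le> (2 * real M + 1) * b (Suc m)"
      using that by (intro mult_left_mono dec) auto
    also have "\<dots> \<le> 2 * (2 * real M - 2 * real m - 1) * b (Suc m)"
      using that nonneg by (intro mult_right_mono) auto
    also have "\<dots> = 2 * ((2 * real m + 1) * b m)" using rec[of m] that by (simp only: mult.assoc)
    also have "\<dots> = 2 * (2 * real m + 1) * b m" by simp
    finally show ?thesis .
  qed
  have key2: "(2 * real M + 1) * (b m * b l) \<le> 2 * ((2 * real m + 1) * (b m)\<^sup>2)"
    if "m < l" "2 * l \<le> M" for m l
    using mult_right_mono[OF key[OF that] nonneg[of m]] by (simp add: power2_eq_square mult_ac)
  have pos: "0 \<le> (2 * real m + 1) * (b m)\<^sup>2" for m by simp
  have low: "(2 * real M + 1) * (b m * b l) \<le>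
      2 * ((2 * real m + 1) * (b m)\<^sup>2 + (2 * real l + 1) * (b l)\<^sup>2)"
    if "m < l" "2 * l \<le> M" for m l
    using key2[OF that] pos[of l] by argo
  have high: "(2 * real M + 1) * (b m)\<^sup>2 \<le> 2 * ((2 * real m + 1) * (b m)\<^sup>2)" if "M < 2 * m" for m
    unfolding mult.assoc[symmetric] using that by (intro mult_right_mono) auto
  \<comment> \<open>Reflect \<open>l\<close> to \<open>M - l\<close> in the lower half. If
    \<open>m\<close> lies below the reflection, \<open>key2\<close> applies; otherwise
    \<open>b m \<le> b l\<close>, and the upper-half index \<open>l\<close> pays for the
    product.\<close>
  have mixed: "(2 * real M + 1) * (b m * b l) \<le>
      2 * ((2 * real m + 1) * (b m)\<^sup>2 + (2 * real l + 1) * (b l)\<^sup>2)"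
    if ml: "2 * m \<le> M" "M < 2 * l" "l \<le> M" for m l
  proof (cases "m < M - l")
    case True
    have "(2 * real M + 1) * (b m * b (M - l)) \<le> 2 * ((2 * real m + 1) * (b m)\<^sup>2)"
      by (rule key2[OF True]) (use ml in simp)
    moreover have "0 \<le> 2 * ((2 * real l + 1) * (b l)\<^sup>2)" by simp
    ultimately show ?thesis
      unfolding sym[OF ml(3)] by argo
  next
    case False
    then have "b m \<le> b l" using dec[of "M - l" m] sym[of l] ml by simp
    then have "b m * b l \<le> (b l)\<^sup>2"
      using nonneg by (simp add: power2_eq_square mult_right_mono)
    then have "(2 * real M + 1) * (b m * b l) \<le> (2 * real M + 1) * (b l)\<^sup>2"
      by (intro mult_left_mono) auto
    then show ?thesis using high[OF ml(2)] pos[of m] by argo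
  qed
  consider "2 * i \<le> M" "2 * j \<le> M" | "2 * i \<le> M" "M < 2 * j"
    | "M < 2 * i" "2 * j \<le> M" | "M < 2 * i" "M < 2 * j"
    by linarith
  then show ?thesis
  proof cases
    case 1
    then show ?thesis
      using low[of i j] low[of j i] ij(3) by (metis linorder_neqE_nat add.commute mult.commute)
  next
    case 2
    then show ?thesis using mixed ij by blast
  next
    case 3
    then show ?thesis using mixed[of j i] ij by (simp add: mult.commute add.commute)
  next
    case 4
    have "2 * (b i * b j) \<le> (b i)\<^sup>2 + (b j)\<^sup>2"
      using sum_squares_bound[of "b i" "b j"] by simp
    then have "(2 * real M + 1) * (b i * b j) \<le> (2 * real M + 1) * (((b i)\<^sup>2 + (b j)\<^sup>2) / 2)"
      by (intro mult_left_mono) auto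
    also have "\<dots> = ((2 * real M + 1) * (b i)\<^sup>2 + (2 * real M + 1) * (b j)\<^sup>2) / 2"
      by (simp add: algebra_simps)
    finally show ?thesis
      using high[OF 4(1)] high[OF 4(2)] pos[of i] pos[of j] by argo
  qed
qed

text \<open>The coefficient of majority on \<open>2 * M + 1\<close> signs at the sets of size \<open>k\<close>.\<close>

definition maj_coeff :: "nat \<Rightarrow> nat \<Rightarrow> real" where
  "maj_coeff M k = (if odd k then tie_coeff (k - 1) (2 * M + 1 - k) / 4 ^ M else 0)"

text \<open>The product can be negative only for distinct odd \<open>k\<close> and \<open>j\<close>.
  For these, \<open>k = 2 * a + 1\<close> and \<open>j = 2 * c + 1\<close> match the weights of
  \<open>two_level_bound\<close>.\<close>

lemma maj_coeff_mult_ge: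
  assumes "k \<le> 2 * M + 1" "j \<le> 2 * M + 1"
  shows "- (2 * (real k * (maj_coeff M k)\<^sup>2 + real j * (maj_coeff M j)\<^sup>2)) \<le> real (2 * M + 1) * (maj_coeff M k * maj_coeff M j)"
proof -
  have pos: "0 \<le> real k * (maj_coeff M k)\<^sup>2" "0 \<le> real j * (maj_coeff M j)\<^sup>2" by auto
  show ?thesis
  proof (cases "odd k \<and> odd j \<and> k \<noteq> j")
    case False
    then have "0 \<le> maj_coeff M k * maj_coeff M j" by (auto simp: maj_coeff_def)
    then have "0 \<le> real (2 * M + 1) * (maj_coeff M k * maj_coeff M j)" by simp
    then show ?thesis using pos by argo
  next
    case True
    then obtain a c where ac: "k = 2 * a + 1" "j = 2 * c + 1" by (meson oddE)
    \<comment> \<open>Absolute values absorb the alternating sign in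
      \<open>tie_coeff_recurrence\<close>, giving the positive recurrence that
      \<open>two_level_bound\<close> expects.\<close>
    define b where "b m = \<bar>tie_coeff (2 * m) (2 * M - 2 * m) / 4 ^ M\<bar>" for m
    have rec: "(2 * real m + 1) * b m = (2 * real M - 2 * real m - 1) * b (Suc m)" if "m < M" for m
    proof -
      define q where "q = 2 * M - 2 * m - 1"
      have q: "2 * M - 2 * m = Suc q" "2 * M - 2 * Suc m = q - 1" "real q = 2 * real M - 2 * real m - 1"
        using that by (auto simp: q_def)
      have "real (2 * m + 1) * tie_coeff (2 * m) (Suc q) = - real q * tie_coeff (2 * Suc m) (q - 1)"
        using tie_coeff_recurrence[of "2 * m + 1" q] by simp
      then have "\<bar>real (2 * m + 1) * tie_coeff (2 * m) (Suc q)\<bar> = \<bar>- real q * tie_coeff (2 * Suc m) (q - 1)\<bar>"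
        by (rule arg_cong)
      then have "real (2 * m + 1) * \<bar>tie_coeff (2 * m) (Suc q)\<bar> = real q * \<bar>tie_coeff (2 * Suc m) (q - 1)\<bar>"
        by (simp only: abs_mult abs_minus_cancel abs_of_nat)
      then show ?thesis unfolding b_def q by (simp add: q(3)[symmetric] field_simps)
    qed
    have "(2 * real M + 1) * (b a * b c) \<le> 2 * ((2 * real a + 1) * (b a)\<^sup>2 + (2 * real c + 1) * (b c)\<^sup>2)"
      by (rule two_level_bound[of b M, OF _ rec]) (use ac assms True in \<open>auto simp: b_def\<close>)
    moreover have l: "\<bar>maj_coeff M k\<bar> = b a" "\<bar>maj_coeff M j\<bar> = b c"
      using ac by (auto simp: maj_coeff_def b_def)
    ultimately have "(2 * real M + 1) * \<bar>maj_coeff M k * maj_coeff M j\<bar> \<le> 2 * (real k * (maj_coeff M k)\<^sup>2 + real j * (maj_coeff M j)\<^sup>2)"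
      unfolding l[symmetric] by (simp add: ac abs_mult add.commute)
    moreover have "(2 * real M + 1) * (- \<bar>maj_coeff M k * maj_coeff M j\<bar>) \<le> (2 * real M + 1) * (maj_coeff M k * maj_coeff M j)"
      by (intro mult_left_mono) auto
    ultimately show ?thesis by (simp add: algebra_simps)
  qed
qed

section \<open>Total influence of majority\<close>

lemma sum_tie_coeff_square:
  assumes "finite A" "card A = 2 * M"
  shows "(\<Sum>S\<in>Pow A. (tie_coeff (card S) (2 * M - card S))\<^sup>2) = 4 ^ M * tie_coeff 0 (2 * M)"
proof -
  have tc: "tie_coeff (card S) (2 * M - card S) = (\<Sum>x\<in>A \<rightarrow>\<^sub>E {-1, 1}. tie (\<Sum>i\<in>A. x i) * chi S x)"
    if "S \<subseteq> A" for S
    using sum_PiE_chi[OF assms(1) that, of tie 0] assms that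
    by (simp add: tie_coeff_def card_Diff_subset finite_subset)
  have "(\<Sum>S\<in>Pow A. (tie_coeff (card S) (2 * M - card S))\<^sup>2) =
      (\<Sum>S\<in>Pow A. (\<Sum>x\<in>A \<rightarrow>\<^sub>E {-1, 1}. tie (\<Sum>i\<in>A. x i) * chi S x)\<^sup>2)"
    using tc by simp
  also have "\<dots> = 2 ^ card A * (\<Sum>x\<in>A \<rightarrow>\<^sub>E {-1, 1}. (tie (\<Sum>i\<in>A. x i))\<^sup>2)"
    using sum_Pow_square[of A "A \<rightarrow>\<^sub>E {-1, 1}" "\<lambda>x. x" "\<lambda>x. tie (\<Sum>i\<in>A. x i)"] assms
    by (simp add: finite_sign_cube)
  also have "(\<Sum>x\<in>A \<rightarrow>\<^sub>E {-1, 1}. (tie (\<Sum>i\<in>A. x i))\<^sup>2) = tie_coeff 0 (2 * M)"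
    using tc[of "{}"] by (simp add: chi_def tie_def if_distrib[of "\<lambda>u. u\<^sup>2"] cong: if_cong)
  finally show ?thesis using assms by (simp add: power_mult)
qed

text \<open>Write \<open>card T\<close> as a count of the coordinates \<open>i \<in> T\<close> and
  exchange sums. Each \<open>i\<close> then contributes the Parseval mass of the tie indicator on
  the other \<open>2 * M\<close> signs, which is the tie probability because the indicator is its
  own square. Enlarging \<open>{..<n}\<close> to \<open>2 * M + 1\<close> signs and filling in the
  even levels only add nonnegative terms.\<close>

lemma total_influence:
  assumes "n \<le> 2 * M + 1"
  shows "(\<Sum>T\<in>Pow {..<n}. real (card T) * (maj_coeff M (card T))\<^sup>2) \<le> real (2 * M + 1) * (tie_coeff 0 (2 * M) / 4 ^ M)"
proof -
  define N where "N = {..<2 * M + 1}"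
  have fin: "finite N" by (simp add: N_def)
  have "(\<Sum>T\<in>Pow {..<n}. real (card T) * (maj_coeff M (card T))\<^sup>2) \<le> (\<Sum>T\<in>Pow N. real (card T) * (maj_coeff M (card T))\<^sup>2)"
    using assms by (intro sum_mono2) (auto simp: N_def)
  also have "\<dots> \<le> (\<Sum>T\<in>Pow N. \<Sum>i\<in>N. if i \<in> T then (tie_coeff (card T - 1) (2 * M + 1 - card T) / 4 ^ M)\<^sup>2 else 0)"
  proof (rule sum_mono)
    fix T assume "T \<in> Pow N"
    then have "N \<inter> T = T" by auto
    then have "(\<Sum>i\<in>N. if i \<in> T then (tie_coeff (card T - 1) (2 * M + 1 - card T) / 4 ^ M)\<^sup>2 else 0) =
        real (card T) * (tie_coeff (card T - 1) (2 * M + 1 - card T) / 4 ^ M)\<^sup>2"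
      using fin by (simp add: sum.If_cases Int_def)
    then show "real (card T) * (maj_coeff M (card T))\<^sup>2 \<le>
        (\<Sum>i\<in>N. if i \<in> T then (tie_coeff (card T - 1) (2 * M + 1 - card T) / 4 ^ M)\<^sup>2 else 0)"
      by (simp add: maj_coeff_def)
  qed
  also have "\<dots> = (\<Sum>i\<in>N. \<Sum>T\<in>Pow N. if i \<in> T then (tie_coeff (card T - 1) (2 * M + 1 - card T) / 4 ^ M)\<^sup>2 else 0)"
    by (rule sum.swap)
  also have "\<dots> = (\<Sum>i\<in>N. tie_coeff 0 (2 * M) / 4 ^ M)"
  proof (rule sum.cong)
    fix i assume i: "i \<in> N"
    have "(\<Sum>T\<in>Pow N. if i \<in> T then (tie_coeff (card T - 1) (2 * M + 1 - card T) / 4 ^ M)\<^sup>2 else 0)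
        = (\<Sum>T\<in>{T \<in> Pow N. i \<in> T}. (tie_coeff (card T - 1) (2 * M + 1 - card T) / 4 ^ M)\<^sup>2)"
      using fin by (simp only: sum.inter_filter finite_Pow_iff)
    also have "\<dots> = (\<Sum>S\<in>Pow (N - {i}). (tie_coeff (card S) (2 * M - card S) / 4 ^ M)\<^sup>2)"
    proof (rule sum.reindex_bij_witness[of _ "insert i" "\<lambda>T. T - {i}"])
      fix T assume "T \<in> {T \<in> Pow N. i \<in> T}"
      then have "card (T - {i}) = card T - 1" "card T > 0"
        using fin finite_subset by (auto simp: card_gt_0_iff)
      then show "(tie_coeff (card (T - {i})) (2 * M - card (T - {i})) / 4 ^ M)\<^sup>2 =
          (tie_coeff (card T - 1) (2 * M + 1 - card T) / 4 ^ M)\<^sup>2"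
        by (simp add: Suc_diff_le)
    qed (use i in auto)
    also have "\<dots> = (\<Sum>S\<in>Pow (N - {i}). (tie_coeff (card S) (2 * M - card S))\<^sup>2) / 16 ^ M"
      by (simp add: power_divide sum_divide_distrib power2_eq_square power_mult_distrib[symmetric])
    also have "\<dots> = tie_coeff 0 (2 * M) / 4 ^ M"
      using i fin by (subst sum_tie_coeff_square)
        (auto simp: N_def field_simps power_mult_distrib[symmetric])
    finally show "(\<Sum>T\<in>Pow N. if i \<in> T then (tie_coeff (card T - 1) (2 * M + 1 - card T) / 4 ^ M)\<^sup>2 else 0)
        = tie_coeff 0 (2 * M) / 4 ^ M" .
  qed simp
  finally show ?thesis by (simp add: N_def)
qed

section \<open>The correlation as a quadratic form with doubly stochastic weights\<close>

lemma sum_kernel_product: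
  fixes a :: "'a set \<Rightarrow> real" and f :: "'b \<Rightarrow> 'a \<Rightarrow> real"
  shows "(\<Sum>x\<in>Q. \<Sum>y\<in>Q. (\<Sum>T\<in>P. a T * (chi T (g x) * chi T (g y))) * (\<Sum>U\<in>P. a U * (chi U (f x) * chi U (f y)))) =
    (\<Sum>T\<in>P. \<Sum>U\<in>P. a T * a U * (\<Sum>x\<in>Q. chi T (g x) * chi U (f x))\<^sup>2)"
proof -
  have "(\<Sum>x\<in>Q. \<Sum>y\<in>Q. (\<Sum>T\<in>P. a T * (chi T (g x) * chi T (g y))) * (\<Sum>U\<in>P. a U * (chi U (f x) * chi U (f y)))) =
    (\<Sum>x\<in>Q. \<Sum>y\<in>Q. \<Sum>p\<in>P \<times> P. a (fst p) * a (snd p) *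
      ((chi (fst p) (g x) * chi (snd p) (f x)) * (chi (fst p) (g y) * chi (snd p) (f y))))"
  proof (intro sum.cong refl)
    fix x y
    have "(\<Sum>T\<in>P. a T * (chi T (g x) * chi T (g y))) * (\<Sum>U\<in>P. a U * (chi U (f x) * chi U (f y))) =
        (\<Sum>p\<in>P \<times> P. (a (fst p) * (chi (fst p) (g x) * chi (fst p) (g y))) *
          (a (snd p) * (chi (snd p) (f x) * chi (snd p) (f y))))"
      by (simp only: sum_product sum.cartesian_product case_prod_unfold)
    then show "(\<Sum>T\<in>P. a T * (chi T (g x) * chi T (g y))) * (\<Sum>U\<in>P. a U * (chi U (f x) * chi U (f y))) =
        (\<Sum>p\<in>P \<times> P. a (fst p) * a (snd p) *
          ((chi (fst p) (g x) * chi (snd p) (f x)) * (chi (fst p) (g y) * chi (snd p) (f y))))"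
      by (simp only: mult_ac)
  qed
  also have "\<dots> = (\<Sum>x\<in>Q. \<Sum>p\<in>P \<times> P. \<Sum>y\<in>Q. a (fst p) * a (snd p) *
      ((chi (fst p) (g x) * chi (snd p) (f x)) * (chi (fst p) (g y) * chi (snd p) (f y))))"
    by (intro sum.cong refl sum.swap)
  also have "\<dots> = (\<Sum>p\<in>P \<times> P. \<Sum>x\<in>Q. \<Sum>y\<in>Q. a (fst p) * a (snd p) *
      ((chi (fst p) (g x) * chi (snd p) (f x)) * (chi (fst p) (g y) * chi (snd p) (f y))))"
    by (rule sum.swap)
  \<comment> \<open>Each summand is a function of \<open>x\<close> times the same function of
    \<open>y\<close>, so the double sum is a square.\<close>
  also have "\<dots> = (\<Sum>p\<in>P \<times> P. a (fst p) * a (snd p) * (\<Sum>x\<in>Q. chi (fst p) (g x) * chi (snd p) (f x))\<^sup>2)"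
    unfolding power2_eq_square sum_product by (simp add: sum_distrib_left)
  finally show ?thesis
    by (simp add: sum.cartesian_product case_prod_unfold)
qed

text \<open>Apply \<open>sum_PiE_chi\<close> to a constant function: a single difference annihilates
  it.\<close>

lemma sum_PiE_chi_zero:
  assumes "finite A" "T \<subseteq> A" "T \<noteq> {}"
  shows "(\<Sum>x\<in>A \<rightarrow>\<^sub>E {-1, 1}. chi T x) = 0"
proof -
  have "dif_op ((sum_op ^^ q) (\<lambda>_. 1)) = (\<lambda>_. 0)" for q
  proof -
    have "(sum_op ^^ q) (\<lambda>_. 1) = (\<lambda>_. 2 ^ q)"
      by (induction q) (auto simp: sum_op_def fun_eq_iff)
    then show ?thesis by (simp add: dif_op_def fun_eq_iff)
  qed
  moreover have "(dif_op ^^ k) (\<lambda>_. 0) = (\<lambda>_. 0)" for k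
    by (induction k) (auto simp: dif_op_def fun_eq_iff)
  moreover have "card T = Suc (card T - 1)"
    using assms finite_subset[of T A] by (simp add: Suc_diff_1[OF card_gt_0_iff[THEN iffD2]] del: One_nat_def)
  ultimately have "(dif_op ^^ card T) ((sum_op ^^ card (A - T)) (\<lambda>_. 1)) = (\<lambda>_. 0)"
    by (metis funpow_Suc_right comp_apply)
  then show ?thesis
    using sum_PiE_chi[OF assms(1,2), of "\<lambda>_. 1" 0] by simp
qed

text \<open>All row and column sums of \<open>W\<close> equal \<open>4 ^ card A\<close>: Parseval
  over \<open>U\<close> uses that \<open>f\<close> is injective into the cube, Parseval over
  \<open>T\<close> that characters square to 1 at \<open>f x\<close>. Weighting the pointwise bound
  by the nonnegative \<open>W\<close> counts the sum of \<open>u\<close> once along rows and once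
  along columns.\<close>

lemma doubly_stochastic_bound:
  fixes a :: "'a set \<Rightarrow> real"
  assumes fin: "finite A" and f: "bij_betw f (A \<rightarrow>\<^sub>E {-1, 1}) (A \<rightarrow>\<^sub>E {-1, 1})"
    and le: "\<And>T U. T \<subseteq> A \<Longrightarrow> U \<subseteq> A \<Longrightarrow> - (u T + u U) \<le> a T * a U"
  shows "(\<Sum>T\<in>Pow A. \<Sum>U\<in>Pow A. a T * a U * (\<Sum>x\<in>A \<rightarrow>\<^sub>E {-1, 1}. chi T x * chi U (f x))\<^sup>2)
    \<ge> - (2 * 4 ^ card A * (\<Sum>T\<in>Pow A. u T))"
proof -
  define Q where "Q = A \<rightarrow>\<^sub>E {-1, 1::real}"
  have Q: "finite Q" "card Q = 2 ^ card A"
    using fin by (auto simp: Q_def finite_sign_cube card_PiE numeral_2_eq_2)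
  define W where "W T U = (\<Sum>x\<in>Q. chi T x * chi U (f x))\<^sup>2" for T U
  have pow: "(2::real) ^ card A * 2 ^ card A = 4 ^ card A"
    by (simp add: power_mult_distrib[symmetric])
  have row: "(\<Sum>U\<in>Pow A. W T U) = 4 ^ card A" if "T \<subseteq> A" for T
  proof -
    have "(\<Sum>U\<in>Pow A. W T U) = 2 ^ card A * (\<Sum>x\<in>Q. (chi T x)\<^sup>2)"
      unfolding W_def using f fin Q by (intro sum_Pow_square) (auto simp: bij_betw_def Q_def)
    also have "(\<Sum>x\<in>Q. (chi T x)\<^sup>2) = (\<Sum>x\<in>Q. 1)"
      using that by (intro sum.cong) (auto simp: Q_def chi_square)
    finally show ?thesis using Q pow by simp
  qed
  have col: "(\<Sum>T\<in>Pow A. W T U) = 4 ^ card A" if "U \<subseteq> A" for U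
  proof -
    have "(\<Sum>T\<in>Pow A. W T U) = (\<Sum>T\<in>Pow A. (\<Sum>x\<in>Q. chi U (f x) * chi T x)\<^sup>2)"
      by (simp add: W_def mult.commute)
    also have "\<dots> = 2 ^ card A * (\<Sum>x\<in>Q. (chi U (f x))\<^sup>2)"
      using fin Q by (intro sum_Pow_square[where g = "\<lambda>x. x"]) (auto simp: Q_def)
    also have "(\<Sum>x\<in>Q. (chi U (f x))\<^sup>2) = (\<Sum>x\<in>Q. 1)"
    proof (rule sum.cong)
      fix x assume "x \<in> Q"
      then have "f x \<in> Q" using f by (auto simp: bij_betw_def Q_def)
      then show "(chi U (f x))\<^sup>2 = 1" using that by (simp add: Q_def chi_square)
    qed simp
    finally show ?thesis using Q pow by simp
  qed
  have "- (2 * 4 ^ card A * (\<Sum>T\<in>Pow A. u T)) =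
      - ((\<Sum>T\<in>Pow A. u T * (\<Sum>U\<in>Pow A. W T U)) + (\<Sum>U\<in>Pow A. u U * (\<Sum>T\<in>Pow A. W T U)))"
    using row col by (simp add: sum_distrib_right[symmetric])
  also have "(\<Sum>U\<in>Pow A. u U * (\<Sum>T\<in>Pow A. W T U)) = (\<Sum>T\<in>Pow A. \<Sum>U\<in>Pow A. u U * W T U)"
    by (subst sum.swap) (simp add: sum_distrib_left)
  also have "- ((\<Sum>T\<in>Pow A. u T * (\<Sum>U\<in>Pow A. W T U)) + \<dots>) =
      (\<Sum>T\<in>Pow A. \<Sum>U\<in>Pow A. - (u T + u U) * W T U)"
    by (simp add: sum_distrib_left sum.distrib algebra_simps sum_subtractf sum_negf)
  also have "\<dots> \<le> (\<Sum>T\<in>Pow A. \<Sum>U\<in>Pow A. a T * a U * W T U)"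
    by (intro sum_mono mult_right_mono le) (auto simp: W_def)
  finally show ?thesis by (simp add: W_def Q_def)
qed

section \<open>Correlation of the two inner products\<close>

text \<open>
  For even \<open>n\<close> this averages \<open>odd_sgn\<close> over one extra random sign. Inner products have the
  parity of \<open>n\<close>, and there \<open>cube_sgn n\<close> is the sign function.
\<close>

definition cube_sgn :: "nat \<Rightarrow> real \<Rightarrow> real" where
  "cube_sgn n = (if odd n then odd_sgn else (\<lambda>t. 1 / 2 * sum_op odd_sgn t))"

text \<open>For even \<open>n\<close> the averaging in \<open>cube_sgn\<close> acts as one more
  \<open>sum_op\<close>, so both parities use \<open>2 * M + 1\<close> signs. The prefactor
  \<open>2 ^ n / 2 ^ (2 * M + 1)\<close> is 1 for odd \<open>n\<close> and 1/2 for even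
  \<open>n\<close>.\<close>

lemma cube_sgn_coeff:
  assumes "k \<le> n"
  shows "(dif_op ^^ k) ((sum_op ^^ (n - k)) (cube_sgn n)) 0 = 2 ^ n * maj_coeff (n div 2) k"
proof -
  define M where "M = n div 2"
  have "(dif_op ^^ k) ((sum_op ^^ (n - k)) (cube_sgn n)) 0 =
      2 ^ n / 2 ^ (2 * M + 1) * (dif_op ^^ k) ((sum_op ^^ (2 * M + 1 - k)) odd_sgn) 0"
  proof (cases "odd n")
    case True
    then have "n = 2 * M + 1" by (auto simp: M_def)
    then show ?thesis using True by (simp add: cube_sgn_def)
  next
    case False
    then have n: "n = 2 * M" by (auto simp: M_def)
    then have e: "2 * M + 1 - k = Suc (n - k)" using assms by simp
    have "cube_sgn n = (\<lambda>t. 1 / 2 * sum_op odd_sgn t)" using False by (simp add: cube_sgn_def)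
    moreover have "(2::real) ^ n / 2 ^ (2 * M + 1) = 1 / 2" using n by simp
    ultimately show ?thesis
      unfolding e by (simp only: op_pow_scale funpow_Suc_right comp_apply)
  qed
  also have "\<dots> = 2 ^ n * maj_coeff M k"
  proof (cases "odd k")
    case True
    then obtain j where "k = Suc j" by (metis oddE Suc_eq_plus1)
    then show ?thesis using True
      by (simp only: odd_sgn_coeff_Suc) (simp add: maj_coeff_def power_mult)
  next
    case False
    then show ?thesis by (simp add: odd_sgn_coeff_even maj_coeff_def)
  qed
  finally show ?thesis by (simp add: M_def)
qed

lemma odd_sgn_of_int: "odd_sgn (of_int m) = (if odd m then sgn (of_int m) else 0)"
proof -
  have "(\<exists>k::int. (of_int m :: real) = 2 * of_int k + 1) \<longleftrightarrow> odd m"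
  proof
    assume "\<exists>k::int. (of_int m :: real) = 2 * of_int k + 1"
    then obtain k :: int where "(of_int m :: real) = of_int (2 * k + 1)" by auto
    then show "odd m" unfolding of_int_eq_iff by simp
  qed (auto elim!: oddE)
  then show ?thesis by (simp add: odd_sgn_def)
qed

text \<open>For even \<open>n\<close>, the neighbours \<open>m + 1\<close> and \<open>m - 1\<close>
  of a nonzero even \<open>m\<close> share its sign, while at \<open>m = 0\<close> they
  cancel.\<close>

lemma cube_sgn_of_int:
  assumes "even (m - int n)"
  shows "cube_sgn n (of_int m) = sgn (of_int m)"
proof (cases "odd n")
  case True
  then show ?thesis using assms by (simp add: cube_sgn_def odd_sgn_of_int)
next
  case False
  then have "even m" using assms by simp
  have e: "sum_op odd_sgn (of_int m) = sgn (of_int (m + 1)) + sgn (of_int (m - 1))"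
    using \<open>even m\<close> odd_sgn_of_int[of "m + 1"] odd_sgn_of_int[of "m - 1"] by (simp add: sum_op_def)
  consider "m \<ge> 2" | "m = 0" | "m \<le> -2"
    using \<open>even m\<close> by (cases "m = 1 \<or> m = -1") (auto, linarith)
  then have "sum_op odd_sgn (of_int m) = 2 * sgn (of_int m)"
    unfolding e by cases (auto simp: sgn_if)
  then show ?thesis using False by (simp add: cube_sgn_def)
qed

lemma inner_prod_parity:
  assumes "x \<in> cube n" "y \<in> cube n"
  shows "\<exists>m::int. inner_prod n x y = of_int m \<and> even (m - int n)"
proof -
  have "\<exists>m::int. (\<Sum>i<k. x i * y i) = of_int m \<and> even (m - int k)" if "k \<le> n" for k
    using that
  proof (induction k)
    case (Suc k)
    then obtain m :: int where m: "(\<Sum>i<k. x i * y i) = of_int m" "even (m - int k)" by auto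
    have "x k \<in> {-1, 1}" "y k \<in> {-1, 1}"
      using PiE_mem[OF assms(1)[unfolded cube_def], of k] PiE_mem[OF assms(2)[unfolded cube_def], of k]
        Suc.prems by simp_all
    then have "x k * y k = of_int 1 \<or> x k * y k = of_int (-1)"
      by auto
    then obtain e :: int where "x k * y k = of_int e" "odd e"
      by (auto intro: that[of 1] that[of "-1"])
    then show ?case using m by (intro exI[of _ "m + e"]) auto
  qed auto
  then show ?thesis by (simp add: inner_prod_def)
qed

lemma sum_cube_sgn_product:
  assumes "bij_betw f (cube n) (cube n)"
  shows "(\<Sum>x\<in>cube n. \<Sum>y\<in>cube n. cube_sgn n (inner_prod n x y) * cube_sgn n (inner_prod n (f x) (f y)))
    \<ge> - (4 * 4 ^ n * (tie_coeff 0 (2 * (n div 2)) / 4 ^ (n div 2)))"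
proof -
  define M where "M = n div 2"
  define A where "A = {..<n}"
  define a where "a T = maj_coeff M (card T)" for T :: "nat set"
  \<comment> \<open>This is the bound of \<open>maj_coeff_mult_ge\<close> divided by
    \<open>2 * M + 1\<close>, a factor that cancels against the one in
    \<open>total_influence\<close>.\<close>
  define u where "u T = 2 / real (2 * M + 1) * (real (card T) * (a T)\<^sup>2)" for T
  have A: "finite A" "card A = n" and cube: "cube n = A \<rightarrow>\<^sub>E {-1, 1}"
    by (auto simp: A_def cube_def)
  have n: "n \<le> 2 * M + 1" by (auto simp: M_def)
  have kernel: "cube_sgn n (inner_prod n x y) = (\<Sum>T\<in>Pow A. a T * (chi T x * chi T y))"
    if "x \<in> cube n" "y \<in> cube n" for x y
  proof -
    have "2 ^ n * cube_sgn n (inner_prod n x y) =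
        (\<Sum>T\<in>Pow A. (dif_op ^^ card T) ((sum_op ^^ card (A - T)) (cube_sgn n)) 0 * (chi T x * chi T y))"
      using fourier_inversion[of A x y "cube_sgn n"] that A by (simp add: cube inner_prod_def A_def)
    also have "\<dots> = (\<Sum>T\<in>Pow A. 2 ^ n * (a T * (chi T x * chi T y)))"
    proof (intro sum.cong refl)
      fix T assume "T \<in> Pow A"
      then have "card T \<le> n" "card (A - T) = n - card T"
        using A card_mono[of A T] by (auto simp: card_Diff_subset finite_subset)
      then show "(dif_op ^^ card T) ((sum_op ^^ card (A - T)) (cube_sgn n)) 0 * (chi T x * chi T y) =
          2 ^ n * (a T * (chi T x * chi T y))"
        by (simp add: cube_sgn_coeff a_def M_def)
    qed
    finally show ?thesis by (simp add: sum_distrib_left[symmetric])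
  qed
  have fx: "f x \<in> cube n" if "x \<in> cube n" for x
    using assms that by (auto simp: bij_betw_def)
  have "- (2 * 4 ^ card A * (\<Sum>T\<in>Pow A. u T)) \<le>
      (\<Sum>T\<in>Pow A. \<Sum>U\<in>Pow A. a T * a U * (\<Sum>x\<in>A \<rightarrow>\<^sub>E {-1, 1}. chi T x * chi U (f x))\<^sup>2)"
  proof (rule doubly_stochastic_bound)
    fix T U assume "T \<subseteq> A" "U \<subseteq> A"
    then have "card T \<le> 2 * M + 1" "card U \<le> 2 * M + 1"
      using A n card_mono[of A T] card_mono[of A U] by auto
    note pair = maj_coeff_mult_ge[OF this]
    define N where "N = real (2 * M + 1)"
    have "N > 0" by (simp add: N_def)
    then have "N * - (2 / N * p + 2 / N * q) = - (2 * (p + q))" for p q :: real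
      by (simp add: field_simps)
    then have "N * - (u T + u U) = - (2 * (real (card T) * (a T)\<^sup>2 + real (card U) * (a U)\<^sup>2))"
      unfolding u_def N_def[symmetric] .
    also have "\<dots> \<le> N * (a T * a U)"
      using pair by (simp only: a_def N_def)
    finally have "N * - (u T + u U) \<le> N * (a T * a U)" .
    then show "- (u T + u U) \<le> a T * a U"
      using \<open>N > 0\<close> by (simp only: mult_le_cancel_left_pos)
  qed (use assms A cube in auto)
  also have "\<dots> = (\<Sum>x\<in>cube n. \<Sum>y\<in>cube n. cube_sgn n (inner_prod n x y) * cube_sgn n (inner_prod n (f x) (f y)))"
    using sum_kernel_product[where g = "\<lambda>x. x" and f = f and Q = "cube n" and P = "Pow A" and a = a]
    by (simp add: kernel fx cube[symmetric])
  finally have "- (2 * 4 ^ n * (\<Sum>T\<in>Pow A. u T)) \<le>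
      (\<Sum>x\<in>cube n. \<Sum>y\<in>cube n. cube_sgn n (inner_prod n x y) * cube_sgn n (inner_prod n (f x) (f y)))"
    using A by simp
  moreover have "(\<Sum>T\<in>Pow A. u T) \<le> 2 * (tie_coeff 0 (2 * M) / 4 ^ M)"
  proof -
    have "(\<Sum>T\<in>Pow A. u T) = 2 / real (2 * M + 1) * (\<Sum>T\<in>Pow A. real (card T) * (maj_coeff M (card T))\<^sup>2)"
      by (simp add: u_def a_def sum_distrib_left)
    also have "\<dots> \<le> 2 / real (2 * M + 1) * (real (2 * M + 1) * (tie_coeff 0 (2 * M) / 4 ^ M))"
      using total_influence[OF n] by (intro mult_left_mono) (auto simp: A_def)
    finally show ?thesis by simp
  qed
  then have "2 * 4 ^ n * (\<Sum>T\<in>Pow A. u T) \<le> 2 * 4 ^ n * (2 * (tie_coeff 0 (2 * M) / 4 ^ M))"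
    by (intro mult_left_mono) auto
  ultimately show ?thesis by (simp add: M_def)
qed

text \<open>For fixed \<open>x\<close>, summing over \<open>y\<close> kills every nonempty
  character, and the coefficient at the empty set is zero because level 0 is even.\<close>

lemma sum_cube_sgn:
  "(\<Sum>x\<in>cube n. \<Sum>y\<in>cube n. cube_sgn n (inner_prod n x y)) = 0"
proof (rule sum.neutral, rule ballI)
  fix x assume x: "x \<in> cube n"
  define A where "A = {..<n}"
  have A: "finite A" "card A = n" and cube: "cube n = A \<rightarrow>\<^sub>E {-1, 1}"
    by (auto simp: A_def cube_def)
  have "2 ^ n * (\<Sum>y\<in>cube n. cube_sgn n (inner_prod n x y)) =
      (\<Sum>y\<in>cube n. \<Sum>T\<in>Pow A. (dif_op ^^ card T) ((sum_op ^^ card (A - T)) (cube_sgn n)) 0 * (chi T x * chi T y))"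
    unfolding sum_distrib_left
    by (rule sum.cong) (use fourier_inversion[of A x _ "cube_sgn n"] x A in \<open>auto simp: cube inner_prod_def A_def\<close>)
  also have "\<dots> = (\<Sum>T\<in>Pow A. (dif_op ^^ card T) ((sum_op ^^ card (A - T)) (cube_sgn n)) 0 * chi T x * (\<Sum>y\<in>cube n. chi T y))"
    by (subst sum.swap) (simp add: sum_distrib_left mult.assoc)
  also have "\<dots> = 0"
  proof (intro sum.neutral ballI)
    fix T assume "T \<in> Pow A"
    show "(dif_op ^^ card T) ((sum_op ^^ card (A - T)) (cube_sgn n)) 0 * chi T x * (\<Sum>y\<in>cube n. chi T y) = 0"
    proof (cases "T = {}")
      case True
      then show ?thesis using cube_sgn_coeff[of 0 n] A by (simp add: maj_coeff_def)
    next
      case False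
      then show ?thesis using sum_PiE_chi_zero[of A T] A \<open>T \<in> Pow A\<close> by (simp add: cube)
    qed
  qed
  finally show "(\<Sum>y\<in>cube n. cube_sgn n (inner_prod n x y)) = 0" by simp
qed

theorem theorem1:
  "\<exists>C::real. \<forall>n::nat. n \<ge> 1 \<longrightarrow>
     (\<forall>f :: (nat \<Rightarrow> real) \<Rightarrow> (nat \<Rightarrow> real). bij_betw f (cube n) (cube n) \<longrightarrow>
        measure_pmf.prob (pair_pmf (pmf_of_set (cube n)) (pmf_of_set (cube n)))
          {(x, y). inner_prod n x y \<ge> 0 \<and> inner_prod n (f x) (f y) \<ge> 0}
        \<ge> 1 / 4 - C / sqrt (real n))"
proof (intro exI[of _ 1] allI impI)
  fix n :: nat and f :: "(nat \<Rightarrow> real) \<Rightarrow> (nat \<Rightarrow> real)"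
  assume n: "n \<ge> 1" and f: "bij_betw f (cube n) (cube n)"
  define Q where "Q = cube n"
  \<comment> \<open>The probability of a tie among \<open>2 * (n div 2)\<close> signs. The argument
    yields the lower bound \<open>1 / 4 - c\<close>, and \<open>c \<le> 1 / sqrt n\<close> makes the
    constant 1 suffice.\<close>
  define c where "c = tie_coeff 0 (2 * (n div 2)) / 4 ^ (n div 2)"
  define E where "E = {(x, y). inner_prod n x y \<ge> 0 \<and> inner_prod n (f x) (f y) \<ge> 0}"
  define s where "s x y = cube_sgn n (inner_prod n x y)" for x y
  have Q: "finite Q" "card Q = 2 ^ n"
    by (auto simp: Q_def cube_def finite_sign_cube card_PiE numeral_2_eq_2)
  then have "Q \<noteq> {}" by auto
  have fQ: "f x \<in> Q" if "x \<in> Q" for x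
    using f that by (auto simp: bij_betw_def Q_def)
  have s: "s x y = sgn (inner_prod n x y)" if "x \<in> Q" "y \<in> Q" for x y
    using inner_prod_parity[of x n y] that cube_sgn_of_int unfolding s_def Q_def by metis
  have pair: "pair_pmf (pmf_of_set Q) (pmf_of_set Q) = pmf_of_set (Q \<times> Q)"
    using Q \<open>Q \<noteq> {}\<close>
    by (intro pmf_eqI) (auto simp: pmf_pair pmf_of_set[OF \<open>Q \<noteq> {}\<close>] pmf_of_set[of "Q \<times> Q"]
        indicator_def card_cartesian_product)
  have "measure_pmf.prob (pair_pmf (pmf_of_set Q) (pmf_of_set Q)) E = real (card ((Q \<times> Q) \<inter> E)) / 4 ^ n"
    unfolding pair using Q \<open>Q \<noteq> {}\<close>
    by (simp add: measure_pmf_of_set card_cartesian_product power_mult_distrib[symmetric])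
  also have "real (card ((Q \<times> Q) \<inter> E)) = (\<Sum>p\<in>Q \<times> Q. if p \<in> E then 1 else 0)"
    using Q by (simp add: sum.If_cases)
  also have "\<dots> = (\<Sum>x\<in>Q. \<Sum>y\<in>Q. if (x, y) \<in> E then 1 else 0)"
    by (simp add: sum.cartesian_product case_prod_unfold)
  finally have prob: "measure_pmf.prob (pair_pmf (pmf_of_set Q) (pmf_of_set Q)) E =
      (\<Sum>x\<in>Q. \<Sum>y\<in>Q. if (x, y) \<in> E then 1 else 0) / 4 ^ n" .
  have zero: "(\<Sum>x\<in>Q. \<Sum>y\<in>Q. s x y) = 0"
    using sum_cube_sgn by (simp add: s_def Q_def)
  have zero': "(\<Sum>x\<in>Q. \<Sum>y\<in>Q. s (f x) (f y)) = 0"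
  proof -
    have "(\<Sum>x\<in>Q. \<Sum>y\<in>Q. s (f x) (f y)) = (\<Sum>x\<in>Q. \<Sum>y\<in>Q. s (f x) y)"
      using f by (intro sum.cong refl sum.reindex_bij_betw) (simp add: Q_def)
    also have "\<dots> = (\<Sum>x\<in>Q. \<Sum>y\<in>Q. s x y)"
      using f by (intro sum.reindex_bij_betw) (simp add: Q_def)
    finally show ?thesis using zero by simp
  qed
  have "4 ^ n * (1 - 4 * c) \<le> (\<Sum>x\<in>Q. \<Sum>y\<in>Q. 1) + (\<Sum>x\<in>Q. \<Sum>y\<in>Q. s x y * s (f x) (f y))"
    using sum_cube_sgn_product[OF f] Q
    by (simp add: s_def Q_def c_def algebra_simps power_mult_distrib[symmetric])
  also have "\<dots> = (\<Sum>x\<in>Q. \<Sum>y\<in>Q. (1 + s x y) * (1 + s (f x) (f y)))"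
    using zero zero' by (simp add: algebra_simps sum.distrib)
  \<comment> \<open>Both values are signs, so each factor is at most 2, and off \<open>E\<close> one
    of the factors is 0. Zero inner products belong to \<open>E\<close>, so ties only help.\<close>
  also have "\<dots> \<le> (\<Sum>x\<in>Q. \<Sum>y\<in>Q. 4 * (if (x, y) \<in> E then 1 else 0))"
  proof (intro sum_mono)
    fix x y assume "x \<in> Q" "y \<in> Q"
    then show "(1 + s x y) * (1 + s (f x) (f y)) \<le> 4 * (if (x, y) \<in> E then 1 else 0)"
      using s[of x y] s[of "f x" "f y"] fQ by (auto simp: E_def sgn_if)
  qed
  also have "\<dots> = 4 * (\<Sum>x\<in>Q. \<Sum>y\<in>Q. if (x, y) \<in> E then 1 else 0)"
    by (simp only: sum_distrib_left)
  finally have "(1 - 4 * c) / 4 \<le> (\<Sum>x\<in>Q. \<Sum>y\<in>Q. if (x, y) \<in> E then 1 else 0) / 4 ^ n"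
    by (simp add: field_simps)
  moreover have "c \<le> 1 / sqrt (real n)"
  proof -
    have "c \<le> 1 / sqrt (real (2 * (n div 2) + 1))"
      unfolding c_def by (rule tie_coeff_central_le)
    also have "\<dots> \<le> 1 / sqrt (real n)"
    proof (intro divide_left_mono real_sqrt_le_mono)
      show "real n \<le> real (2 * (n div 2) + 1)" by linarith
    qed (use n in auto)
    finally show ?thesis .
  qed
  ultimately have "1 / 4 - 1 / sqrt (real n) \<le> (\<Sum>x\<in>Q. \<Sum>y\<in>Q. if (x, y) \<in> E then 1 else 0) / 4 ^ n"
    by argo
  then show "1 / 4 - 1 / sqrt (real n) \<le> measure_pmf.prob (pair_pmf (pmf_of_set (cube n)) (pmf_of_set (cube n)))
          {(x, y). inner_prod n x y \<ge> 0 \<and> inner_prod n (f x) (f y) \<ge> 0}"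
    unfolding prob[symmetric] by (simp only: Q_def E_def)
qed

end
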